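(* Let $(G,\circ,\cdot)$ and $(G,\cdot',\star)$ be two skew braces on the same underlying set $G$ which are related via a Drinfeld twist. Then their respective additive groups $(G,\cdot)$ and $(G,\star)$ are isomorphic.
   Context: For a map $f:G^2\to G^2$, write $f_{12}=f\times\mathrm{id}_G$ and $f_{23}=\mathrm{id}_G\times f$ as maps $G^3\to G^3$. For a group $(G,m,e)$, $m_{12}(x,y,z)=(m(x,y),z)$ and $m_{23}(x,y,z)=(x,m(y,z))$. Juxtaposition of maps denotes composition. A skew (left) brace $(G,\bullet,\ast)$ is a set $G$ with two group structures satisfying $a\bullet(b\ast c)=(a\bullet b)\ast a^{\ast}\ast(a\bullet c)$ for all $a,b,c$, where $a^\ast$ is the inverse of $a$ in $(G,\ast)$. In the notation $(G,\bullet,\ast)$ the second operation is the additive one: $(G,\ast)$ is called the additive group. The two groups have the same identity element $e$. A braiding operator on a group $(G,m,e)$ is a map $r:G^2\to G^2$ satisfying $r(e,g)=(g,e)$, $r(g,e)=(e,g)$ for all $g$; $r m_{12}=m_{23}r_{12}r_{23}$; $r m_{23}=m_{12}r_{23}r_{12}$; and $mr=m$. Skew braces are equivalent to groups with braiding operators: the skew brace $(G,\bullet,\ast)$ corresponds to the group $(G,\bullet)$ with braiding operator $r(x,y)=(\sigma_x(y),\gamma_y(x))$, where $\sigma_x(y)=x^{\ast}\ast(x\bullet y)$ and $\gamma_y(x)$ is determined by $\sigma_x(y)\bullet\gamma_y(x)=x\bullet y$; conversely $x\ast y=x\bullet\sigma_x^{-1}(y)$. A Drinfeld twist on a group $(G,m,e)$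 with braiding operator $r$ is a triple of invertible maps $F:G^2\to G^2$, $\Phi,\Psi:G^3\to G^3$ satisfying (T1) $F_{12}\Psi=F_{23}\Phi$, (T2) $\Phi r_{23}=r_{23}\Phi$, (T3) $\Psi r_{12}=r_{12}\Psi$, and, for all $x,y,z\in G$, (G1) $\Psi(x,y,e)=(x,y,e)$ and $\Phi(e,x,y)=(e,x,y)$; (G2) $F(e,x)=(e,x)$ and $F(x,e)=(x,e)$; (G3) $m_{23}\Phi(x,y,z)=F(x,m(y,z))$; (G4) $m_{12}\Psi(x,y,z)=F(m(x,y),z)$. For such a twist $(G,mF^{-1},e)$ is a group with braiding operator $FrF^{-1}$. Two skew braces on $G$ are related via a Drinfeld twist if, viewing them as groups with braiding operators $(G,m,e,r)$ and $(G,m',e',r')$, there is a Drinfeld twist $(F,\Phi,\Psi)$ on $(G,m,e,r)$ with $m'=mF^{-1}$, $e'=e$ and $r'=FrF^{-1}$ (this relation is symmetric). *)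

theory Defs
  imports "HOL-Algebra.Group"
begin

text \<open>
  All structures live on a carrier set \<open>G\<close>; the squares and cubes of \<open>G\<close> are
  \<open>G \<times> G\<close> and \<open>G \<times> G \<times> G\<close>, triples being nested to the right.
  Equations between maps are required only on these sets.
\<close>

definition on12 :: "('a \<times> 'a \<Rightarrow> 'a \<times> 'a) \<Rightarrow> 'a \<times> 'a \<times> 'a \<Rightarrow> 'a \<times> 'a \<times> 'a"
  where "on12 f = (\<lambda>(x, y, z). (fst (f (x, y)), snd (f (x, y)), z))"

definition on23 :: "('a \<times> 'a \<Rightarrow> 'a \<times> 'a) \<Rightarrow> 'a \<times> 'a \<times> 'a \<Rightarrow> 'a \<times> 'a \<times> 'a"
  where "on23 f = (\<lambda>(x, y, z). (x, f (y, z)))"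

definition mul :: "('a, 'b) monoid_scheme \<Rightarrow> 'a \<times> 'a \<Rightarrow> 'a"
  where "mul G = (\<lambda>(x, y). x \<otimes>\<^bsub>G\<^esub> y)"

definition mul12 :: "('a, 'b) monoid_scheme \<Rightarrow> 'a \<times> 'a \<times> 'a \<Rightarrow> 'a \<times> 'a"
  where "mul12 G = (\<lambda>(x, y, z). (mul G (x, y), z))"

definition mul23 :: "('a, 'b) monoid_scheme \<Rightarrow> 'a \<times> 'a \<times> 'a \<Rightarrow> 'a \<times> 'a"
  where "mul23 G = (\<lambda>(x, y, z). (x, mul G (y, z)))"

locale braiding_operator = group G
  for G :: "('a, 'b) monoid_scheme" (structure)
    and r :: "'a \<times> 'a \<Rightarrow> 'a \<times> 'a" +
  assumes r_maps: "r \<in> carrier G \<times> carrier G \<rightarrow> carrier G \<times> carrier G"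
    and r_one_left: "g \<in> carrier G \<Longrightarrow> r (\<one>, g) = (g, \<one>)"
    and r_one_right: "g \<in> carrier G \<Longrightarrow> r (g, \<one>) = (\<one>, g)"
    and r_m12: "t \<in> carrier G \<times> carrier G \<times> carrier G
      \<Longrightarrow> r (mul12 G t) = mul23 G (on12 r (on23 r t))"
    and r_m23: "t \<in> carrier G \<times> carrier G \<times> carrier G
      \<Longrightarrow> r (mul23 G t) = mul12 G (on23 r (on12 r t))"
    and m_r: "p \<in> carrier G \<times> carrier G \<Longrightarrow> mul G (r p) = mul G p"

text \<open>
  In \<open>skew_brace M A\<close> the second group \<open>A\<close> is the additive one. That \<open>M\<close> and \<open>A\<close>
  have the same identity element is a consequence of the axioms.
\<close>

locale skew_brace = mult: group M + add: group A
  for M :: "('a, 'b) monoid_scheme" and A :: "('a, 'c) monoid_scheme" +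
  assumes carrier_eq: "carrier A = carrier M"
    and brace: "\<lbrakk>a \<in> carrier M; b \<in> carrier M; c \<in> carrier M\<rbrakk> \<Longrightarrow>
      a \<otimes>\<^bsub>M\<^esub> (b \<otimes>\<^bsub>A\<^esub> c) = (a \<otimes>\<^bsub>M\<^esub> b) \<otimes>\<^bsub>A\<^esub> inv\<^bsub>A\<^esub> a \<otimes>\<^bsub>A\<^esub> (a \<otimes>\<^bsub>M\<^esub> c)"

definition brace_sigma ::
  "('a, 'b) monoid_scheme \<Rightarrow> ('a, 'c) monoid_scheme \<Rightarrow> 'a \<Rightarrow> 'a \<Rightarrow> 'a"
  where "brace_sigma M A x y = inv\<^bsub>A\<^esub> x \<otimes>\<^bsub>A\<^esub> (x \<otimes>\<^bsub>M\<^esub> y)"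

text \<open>The value of \<open>brace_gamma\<close> is the unique solution \<open>g\<close> of
  \<open>brace_sigma M A x y \<otimes>\<^bsub>M\<^esub> g = x \<otimes>\<^bsub>M\<^esub> y\<close>.\<close>

definition brace_gamma ::
  "('a, 'b) monoid_scheme \<Rightarrow> ('a, 'c) monoid_scheme \<Rightarrow> 'a \<Rightarrow> 'a \<Rightarrow> 'a"
  where "brace_gamma M A y x = inv\<^bsub>M\<^esub> (brace_sigma M A x y) \<otimes>\<^bsub>M\<^esub> (x \<otimes>\<^bsub>M\<^esub> y)"

definition brace_braiding ::
  "('a, 'b) monoid_scheme \<Rightarrow> ('a, 'c) monoid_scheme \<Rightarrow> 'a \<times> 'a \<Rightarrow> 'a \<times> 'a"
  where "brace_braiding M A = (\<lambda>(x, y). (brace_sigma M A x y, brace_gamma M A y x))"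

locale drinfeld_twist = braiding_operator G r
  for G :: "('a, 'b) monoid_scheme" (structure)
    and r :: "'a \<times> 'a \<Rightarrow> 'a \<times> 'a" +
  fixes F :: "'a \<times> 'a \<Rightarrow> 'a \<times> 'a"
    and \<Phi> \<Psi> :: "'a \<times> 'a \<times> 'a \<Rightarrow> 'a \<times> 'a \<times> 'a"
  assumes F_bij: "bij_betw F (carrier G \<times> carrier G) (carrier G \<times> carrier G)"
    and Phi_bij: "bij_betw \<Phi> (carrier G \<times> carrier G \<times> carrier G)
                             (carrier G \<times> carrier G \<times> carrier G)"
    and Psi_bij: "bij_betw \<Psi> (carrier G \<times> carrier G \<times> carrier G)
                             (carrier G \<times> carrier G \<times> carrier G)"
    and T1: "t \<in> carrier G \<times> carrier G \<times> carrier G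
      \<Longrightarrow> on12 F (\<Psi> t) = on23 F (\<Phi> t)"
    and T2: "t \<in> carrier G \<times> carrier G \<times> carrier G
      \<Longrightarrow> \<Phi> (on23 r t) = on23 r (\<Phi> t)"
    and T3: "t \<in> carrier G \<times> carrier G \<times> carrier G
      \<Longrightarrow> \<Psi> (on12 r t) = on12 r (\<Psi> t)"
    and G1_Psi: "\<lbrakk>x \<in> carrier G; y \<in> carrier G\<rbrakk> \<Longrightarrow> \<Psi> (x, y, \<one>) = (x, y, \<one>)"
    and G1_Phi: "\<lbrakk>x \<in> carrier G; y \<in> carrier G\<rbrakk> \<Longrightarrow> \<Phi> (\<one>, x, y) = (\<one>, x, y)"
    and G2_left: "x \<in> carrier G \<Longrightarrow> F (\<one>, x) = (\<one>, x)"
    and G2_right: "x \<in> carrier G \<Longrightarrow> F (x, \<one>) = (x, \<one>)"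
    and G3: "\<lbrakk>x \<in> carrier G; y \<in> carrier G; z \<in> carrier G\<rbrakk>
      \<Longrightarrow> mul23 G (\<Phi> (x, y, z)) = F (x, mul G (y, z))"
    and G4: "\<lbrakk>x \<in> carrier G; y \<in> carrier G; z \<in> carrier G\<rbrakk>
      \<Longrightarrow> mul12 G (\<Psi> (x, y, z)) = F (mul G (x, y), z)"

text \<open>The two skew braces \<open>(M, A)\<close> and \<open>(M', A')\<close> are meant to share their underlying set
  \<open>carrier M\<close>; the inverse of \<open>F\<close> is taken on its square.\<close>

definition related_via_drinfeld_twist ::
  "('a, 'b) monoid_scheme \<Rightarrow> ('a, 'c) monoid_scheme \<Rightarrow>
   ('a, 'd) monoid_scheme \<Rightarrow> ('a, 'e) monoid_scheme \<Rightarrow> bool"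
  where "related_via_drinfeld_twist M A M' A' \<longleftrightarrow>
    (\<exists>F \<Phi> \<Psi>. drinfeld_twist M (brace_braiding M A) F \<Phi> \<Psi> \<and>
      (\<forall>p \<in> carrier M \<times> carrier M.
         mul M' p = mul M (inv_into (carrier M \<times> carrier M) F p)) \<and>
      \<one>\<^bsub>M'\<^esub> = \<one>\<^bsub>M\<^esub> \<and>
      (\<forall>p \<in> carrier M \<times> carrier M.
         brace_braiding M' A' p
           = F (brace_braiding M A (inv_into (carrier M \<times> carrier M) F p))))"

context skew_brace
begin

lemma add_closed [simp, intro]:
  "\<lbrakk>x \<in> carrier M; y \<in> carrier M\<rbrakk> \<Longrightarrow> x \<otimes>\<^bsub>A\<^esub> y \<in> carrier M"
  "\<one>\<^bsub>A\<^esub> \<in> carrier M"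
  "x \<in> carrier M \<Longrightarrow> inv\<^bsub>A\<^esub> x \<in> carrier M"
  using add.m_closed add.one_closed add.inv_closed by (simp_all add: carrier_eq)

lemma one_eq: "\<one>\<^bsub>A\<^esub> = \<one>\<^bsub>M\<^esub>"
proof -
  have "\<one>\<^bsub>A\<^esub> = \<one>\<^bsub>A\<^esub> \<otimes>\<^bsub>A\<^esub> inv\<^bsub>A\<^esub> \<one>\<^bsub>M\<^esub> \<otimes>\<^bsub>A\<^esub> \<one>\<^bsub>A\<^esub>"
    using brace[of "\<one>\<^bsub>M\<^esub>" "\<one>\<^bsub>A\<^esub>" "\<one>\<^bsub>A\<^esub>"] by (simp add: carrier_eq)
  then have "inv\<^bsub>A\<^esub> \<one>\<^bsub>M\<^esub> = \<one>\<^bsub>A\<^esub>" by (simp add: carrier_eq)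
  then show ?thesis
    by (metis add.inv_inv add.inv_one carrier_eq mult.one_closed)
qed

lemma sigma_closed [simp, intro]:
  "\<lbrakk>x \<in> carrier M; y \<in> carrier M\<rbrakk> \<Longrightarrow> brace_sigma M A x y \<in> carrier M"
  by (simp add: brace_sigma_def)

lemma gamma_closed [simp, intro]:
  "\<lbrakk>x \<in> carrier M; y \<in> carrier M\<rbrakk> \<Longrightarrow> brace_gamma M A y x \<in> carrier M"
  by (simp add: brace_gamma_def)

lemma mult_eq_add_sigma:
  "\<lbrakk>x \<in> carrier M; y \<in> carrier M\<rbrakk> \<Longrightarrow> x \<otimes>\<^bsub>M\<^esub> y = x \<otimes>\<^bsub>A\<^esub> brace_sigma M A x y"
  by (simp add: brace_sigma_def carrier_eq add.m_assoc[symmetric])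

lemma sigma_gamma:
  "\<lbrakk>x \<in> carrier M; y \<in> carrier M\<rbrakk>
    \<Longrightarrow> brace_sigma M A x y \<otimes>\<^bsub>M\<^esub> brace_gamma M A y x = x \<otimes>\<^bsub>M\<^esub> y"
  by (simp add: brace_gamma_def mult.m_assoc[symmetric])

lemma gamma_unique:
  assumes "x \<in> carrier M" "y \<in> carrier M" "g \<in> carrier M"
    and "brace_sigma M A x y \<otimes>\<^bsub>M\<^esub> g = x \<otimes>\<^bsub>M\<^esub> y"
  shows "brace_gamma M A y x = g"
  using assms by (simp add: brace_gamma_def flip: assms(4)) (simp flip: mult.m_assoc)

lemma sigma_add:
  assumes "x \<in> carrier M" "y \<in> carrier M" "z \<in> carrier M"
  shows "brace_sigma M A x (y \<otimes>\<^bsub>A\<^esub> z) = brace_sigma M A x y \<otimes>\<^bsub>A\<^esub> brace_sigma M A x z"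
  using assms by (simp add: brace_sigma_def brace carrier_eq add.m_assoc)

lemma sigma_mult:
  assumes "x \<in> carrier M" "y \<in> carrier M" "z \<in> carrier M"
  shows "brace_sigma M A (x \<otimes>\<^bsub>M\<^esub> y) z = brace_sigma M A x (brace_sigma M A y z)"
proof -
  have "(x \<otimes>\<^bsub>M\<^esub> y) \<otimes>\<^bsub>A\<^esub> brace_sigma M A (x \<otimes>\<^bsub>M\<^esub> y) z = x \<otimes>\<^bsub>M\<^esub> (y \<otimes>\<^bsub>M\<^esub> z)"
    using assms by (simp flip: mult_eq_add_sigma add: mult.m_assoc)
  also have "\<dots> = x \<otimes>\<^bsub>A\<^esub> brace_sigma M A x (y \<otimes>\<^bsub>A\<^esub> brace_sigma M A y z)"
    using assms by (simp flip: mult_eq_add_sigma)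
  also have "\<dots> = (x \<otimes>\<^bsub>A\<^esub> brace_sigma M A x y) \<otimes>\<^bsub>A\<^esub> brace_sigma M A x (brace_sigma M A y z)"
    using assms by (simp add: sigma_add add.m_assoc carrier_eq)
  also have "\<dots> = (x \<otimes>\<^bsub>M\<^esub> y) \<otimes>\<^bsub>A\<^esub> brace_sigma M A x (brace_sigma M A y z)"
    using assms by (simp add: mult_eq_add_sigma)
  finally show ?thesis
    using assms add.Units_l_cancel[of "x \<otimes>\<^bsub>M\<^esub> y"] by (simp add: carrier_eq)
qed

lemma sigma_mult_right:
  assumes "x \<in> carrier M" "y \<in> carrier M" "z \<in> carrier M"
  shows "brace_sigma M A x (y \<otimes>\<^bsub>M\<^esub> z)
    = brace_sigma M A x y \<otimes>\<^bsub>M\<^esub> brace_sigma M A (brace_gamma M A y x) z"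
proof -
  have "brace_sigma M A x y \<otimes>\<^bsub>M\<^esub> brace_sigma M A (brace_gamma M A y x) z
    = brace_sigma M A x y \<otimes>\<^bsub>A\<^esub>
        brace_sigma M A (brace_sigma M A x y \<otimes>\<^bsub>M\<^esub> brace_gamma M A y x) z"
    using assms sigma_mult[of "brace_sigma M A x y" "brace_gamma M A y x" z]
      mult_eq_add_sigma[of "brace_sigma M A x y" "brace_sigma M A (brace_gamma M A y x) z"]
    by simp
  also have "\<dots> = brace_sigma M A x y \<otimes>\<^bsub>A\<^esub> brace_sigma M A x (brace_sigma M A y z)"
    using assms by (simp add: sigma_gamma sigma_mult)
  also have "\<dots> = brace_sigma M A x (y \<otimes>\<^bsub>M\<^esub> z)"
    using assms by (simp add: sigma_add mult_eq_add_sigma)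
  finally show ?thesis ..
qed

lemma braiding_operator_brace_braiding: "braiding_operator M (brace_braiding M A)"
proof
  show "brace_braiding M A \<in> carrier M \<times> carrier M \<rightarrow> carrier M \<times> carrier M"
    by (auto simp: brace_braiding_def)
next
  fix g assume "g \<in> carrier M"
  then show "brace_braiding M A (\<one>\<^bsub>M\<^esub>, g) = (g, \<one>\<^bsub>M\<^esub>)"
    using one_eq by (simp add: brace_braiding_def brace_gamma_def brace_sigma_def carrier_eq
        flip: one_eq)
next
  fix g assume g: "g \<in> carrier M"
  then have "brace_sigma M A g \<one>\<^bsub>M\<^esub> = \<one>\<^bsub>M\<^esub>"
    by (simp add: brace_sigma_def carrier_eq one_eq)
  with g show "brace_braiding M A (g, \<one>\<^bsub>M\<^esub>) = (\<one>\<^bsub>M\<^esub>, g)"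
    by (simp add: brace_braiding_def brace_gamma_def)
next
  fix t assume "t \<in> carrier M \<times> carrier M \<times> carrier M"
  then obtain x y z where t: "t = (x, y, z)"
    and c: "x \<in> carrier M" "y \<in> carrier M" "z \<in> carrier M" by auto
  let ?s = "brace_sigma M A" and ?g = "brace_gamma M A"
  have "?g z (x \<otimes>\<^bsub>M\<^esub> y) = ?g (?s y z) x \<otimes>\<^bsub>M\<^esub> ?g z y"
  proof (rule gamma_unique)
    have "?s (x \<otimes>\<^bsub>M\<^esub> y) z \<otimes>\<^bsub>M\<^esub> (?g (?s y z) x \<otimes>\<^bsub>M\<^esub> ?g z y) = (x \<otimes>\<^bsub>M\<^esub> ?s y z) \<otimes>\<^bsub>M\<^esub> ?g z y"
      using c by (simp add: sigma_mult sigma_gamma flip: mult.m_assoc)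
    also have "\<dots> = x \<otimes>\<^bsub>M\<^esub> y \<otimes>\<^bsub>M\<^esub> z"
      using c by (simp add: sigma_gamma mult.m_assoc)
    finally show "?s (x \<otimes>\<^bsub>M\<^esub> y) z \<otimes>\<^bsub>M\<^esub> (?g (?s y z) x \<otimes>\<^bsub>M\<^esub> ?g z y) = x \<otimes>\<^bsub>M\<^esub> y \<otimes>\<^bsub>M\<^esub> z" .
  qed (use c in auto)
  then show "brace_braiding M A (mul12 M t)
      = mul23 M (on12 (brace_braiding M A) (on23 (brace_braiding M A) t))"
    using c by (simp add: t mul12_def mul23_def mul_def on12_def on23_def brace_braiding_def sigma_mult)
  have "?g (y \<otimes>\<^bsub>M\<^esub> z) x = ?g z (?g y x)"
  proof (rule gamma_unique)
    have "?s x (y \<otimes>\<^bsub>M\<^esub> z) \<otimes>\<^bsub>M\<^esub> ?g z (?g y x) = ?s x y \<otimes>\<^bsub>M\<^esub> (?g y x \<otimes>\<^bsub>M\<^esub> z)"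
      using c by (simp add: sigma_mult_right sigma_gamma mult.m_assoc)
    also have "\<dots> = x \<otimes>\<^bsub>M\<^esub> (y \<otimes>\<^bsub>M\<^esub> z)"
      using c by (simp add: sigma_gamma flip: mult.m_assoc)
    finally show "?s x (y \<otimes>\<^bsub>M\<^esub> z) \<otimes>\<^bsub>M\<^esub> ?g z (?g y x) = x \<otimes>\<^bsub>M\<^esub> (y \<otimes>\<^bsub>M\<^esub> z)" .
  qed (use c in auto)
  then show "brace_braiding M A (mul23 M t)
      = mul12 M (on23 (brace_braiding M A) (on12 (brace_braiding M A) t))"
    using c
    by (simp add: t mul12_def mul23_def mul_def on12_def on23_def brace_braiding_def sigma_mult_right)
next
  fix p assume "p \<in> carrier M \<times> carrier M"
  then show "mul M (brace_braiding M A p) = mul M p"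
    by (auto simp: mul_def brace_braiding_def sigma_gamma)
qed

end

end

theory Submission
  imports Defs
begin

text \<open>
  Write \<open>m, m'\<close> for the products of \<open>M, M'\<close>, \<open>+, +'\<close> for those of \<open>A, A'\<close>, and \<open>r, r'\<close> for the
  braidings. The isomorphism is \<open>p x = fst (F (x, x\<inverse>))\<close>, the inverse being taken in \<open>M\<close>.

  It is a homomorphism because of what the twist does to triples. By (T1) the map
  \<open>F\<^sub>3 = F\<^sub>1\<^sub>2 \<Psi> = F\<^sub>2\<^sub>3 \<Phi>\<close> has two descriptions; the first together with (T3) shows that it
  intertwines \<open>r\<^sub>1\<^sub>2\<close> with \<open>r'\<^sub>1\<^sub>2\<close>, the second together with (T2) that it intertwines \<open>r\<^sub>2\<^sub>3\<close>
  with \<open>r'\<^sub>2\<^sub>3\<close>. By (G3) and \<open>m' F = m\<close> it carries the \<open>m\<close>-product of a triple to the \<open>m'\<close>-product of its image,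
  and the first entry of \<open>F\<^sub>3 (x, y, z)\<close> is that of \<open>F (x, m (y, z))\<close>. If the triple has product
  \<open>1\<close>, this entry is therefore \<open>p x\<close>.

  Now the braiding records the additive structure: by \<open>m (x, y) = x + \<sigma>\<^sub>x y\<close>, a triple has
  \<open>m\<close>-product \<open>x + \<sigma>\<^sub>x y + \<sigma>\<^sub>x (\<sigma>\<^sub>y z)\<close>, and the three summands are the first entries of
  the triples \<open>t\<close>, \<open>r\<^sub>1\<^sub>2 t\<close> and \<open>r\<^sub>1\<^sub>2 (r\<^sub>2\<^sub>3 t)\<close>, which all have the same product. Since \<open>F\<^sub>3\<close>
  respects all of this, \<open>p\<close> maps the three summands of a triple of product \<open>1\<close> to those of its image,
  that is, \<open>u + v + w = 1\<close> implies \<open>p u +' p v +' p w = 1\<close>. With \<open>p 1 = 1\<close>, this makes \<open>p\<close>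
  a homomorphism.

  It is bijective because \<open>F\<close> is a bijection between the pairs of \<open>m\<close>-product \<open>1\<close> and those of
  \<open>m'\<close>-product \<open>1\<close>, and in either group such a pair is determined by its first entry.
\<close>

lemma (in skew_brace) mult3_eq_add_sigma:
  assumes "x \<in> carrier M" "y \<in> carrier M" "z \<in> carrier M"
  shows "x \<otimes>\<^bsub>M\<^esub> y \<otimes>\<^bsub>M\<^esub> z
    = x \<otimes>\<^bsub>A\<^esub> brace_sigma M A x y \<otimes>\<^bsub>A\<^esub> brace_sigma M A x (brace_sigma M A y z)"
proof -
  have "x \<otimes>\<^bsub>M\<^esub> y \<otimes>\<^bsub>M\<^esub> z = (x \<otimes>\<^bsub>M\<^esub> y) \<otimes>\<^bsub>A\<^esub> brace_sigma M A (x \<otimes>\<^bsub>M\<^esub> y) z"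
    using assms by (intro mult_eq_add_sigma) simp_all
  also have "\<dots> = (x \<otimes>\<^bsub>M\<^esub> y) \<otimes>\<^bsub>A\<^esub> brace_sigma M A x (brace_sigma M A y z)"
    by (simp only: sigma_mult[OF assms])
  also have "\<dots> = (x \<otimes>\<^bsub>A\<^esub> brace_sigma M A x y) \<otimes>\<^bsub>A\<^esub> brace_sigma M A x (brace_sigma M A y z)"
    by (simp only: mult_eq_add_sigma[OF assms(1,2)])
  finally show ?thesis .
qed

text \<open>Such a map sends \<open>(u, 1, - u)\<close> to a triple of sum \<open>1\<close>, so it respects inverses; applied to
  \<open>(u, v, - (u + v))\<close> the hypothesis then gives additivity.\<close>

lemma hom_if_preserves_trivial_triples:
  assumes "group A" "group B"
    and closed: "\<And>u. u \<in> carrier A \<Longrightarrow> f u \<in> carrier B"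
    and one: "f \<one>\<^bsub>A\<^esub> = \<one>\<^bsub>B\<^esub>"
    and triple: "\<And>u v. \<lbrakk>u \<in> carrier A; v \<in> carrier A\<rbrakk>
      \<Longrightarrow> f u \<otimes>\<^bsub>B\<^esub> f v \<otimes>\<^bsub>B\<^esub> f (inv\<^bsub>A\<^esub> (u \<otimes>\<^bsub>A\<^esub> v)) = \<one>\<^bsub>B\<^esub>"
  shows "f \<in> hom A B"
proof (rule homI)
  interpret A: group A by fact
  interpret B: group B by fact
  fix u v assume u: "u \<in> carrier A" and v: "v \<in> carrier A"
  have inv_f: "inv\<^bsub>B\<^esub> f (inv\<^bsub>A\<^esub> w) = f w" if w: "w \<in> carrier A" for w
    using triple[OF w A.one_closed] w by (intro B.inv_equality) (simp_all add: one closed)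
  have "f u \<otimes>\<^bsub>B\<^esub> f v = inv\<^bsub>B\<^esub> f (inv\<^bsub>A\<^esub> (u \<otimes>\<^bsub>A\<^esub> v))"
    using triple[OF u v] u v by (intro B.inv_equality[symmetric]) (simp_all add: closed)
  also have "\<dots> = f (u \<otimes>\<^bsub>A\<^esub> v)"
    using u v by (simp add: inv_f)
  finally show "f (u \<otimes>\<^bsub>A\<^esub> v) = f u \<otimes>\<^bsub>B\<^esub> f v" ..
qed (rule closed)

locale twisted_skew_braces =
  old: skew_brace M A + new: skew_brace M' A' +
  twist: drinfeld_twist M "brace_braiding M A" F \<Phi> \<Psi>
  for M :: "('a, 'b) monoid_scheme" and A :: "('a, 'c) monoid_scheme"
    and M' :: "('a, 'd) monoid_scheme" and A' :: "('a, 'e) monoid_scheme"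
    and F \<Phi> \<Psi> +
  assumes carrier_new: "carrier M' = carrier M"
    and one_new: "\<one>\<^bsub>M'\<^esub> = \<one>\<^bsub>M\<^esub>"
    and mul_F: "q \<in> carrier M \<times> carrier M \<Longrightarrow> mul M' (F q) = mul M q"
    and braiding_F: "q \<in> carrier M \<times> carrier M
      \<Longrightarrow> brace_braiding M' A' (F q) = F (brace_braiding M A q)"
begin

abbreviation "cube \<equiv> carrier M \<times> carrier M \<times> carrier M"

definition F3 :: "'a \<times> 'a \<times> 'a \<Rightarrow> 'a \<times> 'a \<times> 'a"
  where "F3 t = on12 F (\<Psi> t)"

definition additive_iso :: "'a \<Rightarrow> 'a"
  where "additive_iso x = fst (F (x, inv\<^bsub>M\<^esub> x))"

lemma F_closed: "q \<in> carrier M \<times> carrier M \<Longrightarrow> F q \<in> carrier M \<times> carrier M"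
  using twist.F_bij by (rule bij_betw_apply)

lemma Phi_closed: "t \<in> cube \<Longrightarrow> \<Phi> t \<in> cube"
  using twist.Phi_bij by (rule bij_betw_apply)

lemma Psi_closed: "t \<in> cube \<Longrightarrow> \<Psi> t \<in> cube"
  using twist.Psi_bij by (rule bij_betw_apply)

lemma F3_eq_Phi: "t \<in> cube \<Longrightarrow> F3 t = on23 F (\<Phi> t)"
  by (simp add: F3_def twist.T1)

lemma F3_closed: assumes "t \<in> cube" shows "F3 t \<in> cube"
proof -
  obtain a b c where "\<Psi> t = (a, b, c)" by (cases "\<Psi> t")
  with Psi_closed[OF assms] F_closed[of "(a, b)"] show ?thesis
    by (auto simp: F3_def on12_def)
qed

lemma on12_braiding_F:
  "t \<in> cube \<Longrightarrow> on12 (brace_braiding M' A') (on12 F t) = on12 F (on12 (brace_braiding M A) t)"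
  by (auto simp: on12_def braiding_F)

lemma on23_braiding_F:
  "t \<in> cube \<Longrightarrow> on23 (brace_braiding M' A') (on23 F t) = on23 F (on23 (brace_braiding M A) t)"
  by (auto simp: on23_def braiding_F)

lemma on12_braiding_closed: "t \<in> cube \<Longrightarrow> on12 (brace_braiding M A) t \<in> cube"
  by (auto simp: on12_def brace_braiding_def)

lemma on23_braiding_closed: "t \<in> cube \<Longrightarrow> on23 (brace_braiding M A) t \<in> cube"
  by (auto simp: on23_def brace_braiding_def)

lemma F3_intertwines_12:
  assumes "t \<in> cube"
  shows "on12 (brace_braiding M' A') (F3 t) = F3 (on12 (brace_braiding M A) t)"
  using assms by (simp add: F3_def on12_braiding_F Psi_closed twist.T3 del: mem_Sigma_iff)

lemma F3_intertwines_23: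
  assumes "t \<in> cube"
  shows "on23 (brace_braiding M' A') (F3 t) = F3 (on23 (brace_braiding M A) t)"
  using assms
  by (simp add: F3_eq_Phi on23_braiding_F Phi_closed on23_braiding_closed twist.T2
      del: mem_Sigma_iff)

text \<open>Through (G3), the map \<open>\<Phi>\<close> can be eliminated from statements about the first entry of
  \<open>F\<^sub>2\<^sub>3 \<Phi>\<close> and about the product of the other two: \<open>F\<^sub>2\<^sub>3\<close> leaves the former alone and
  turns the \<open>M\<close>-product of the latter into an \<open>M'\<close>-product.\<close>

lemma fst_F3:
  assumes "x \<in> carrier M" "y \<in> carrier M" "z \<in> carrier M"
  shows "fst (F3 (x, y, z)) = fst (F (x, y \<otimes>\<^bsub>M\<^esub> z))"
proof -
  have "fst (F3 (x, y, z)) = fst (mul23 M (\<Phi> (x, y, z)))"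
    using assms by (simp add: F3_eq_Phi on23_def mul23_def split: prod.split)
  then show ?thesis
    using assms by (simp add: twist.G3 mul_def)
qed

lemma F3_preserves_product:
  assumes c: "x \<in> carrier M" "y \<in> carrier M" "z \<in> carrier M"
    and abc: "F3 (x, y, z) = (a, b, c)"
  shows "a \<otimes>\<^bsub>M'\<^esub> b \<otimes>\<^bsub>M'\<^esub> c = x \<otimes>\<^bsub>M\<^esub> y \<otimes>\<^bsub>M\<^esub> z"
proof -
  obtain a' b' c' where Phi: "\<Phi> (x, y, z) = (a', b', c')"
    by (cases "\<Phi> (x, y, z)")
  have c': "a' \<in> carrier M" "b' \<in> carrier M" "c' \<in> carrier M"
    using Phi_closed[of "(x, y, z)"] c by (auto simp: Phi)
  have a: "a = a'" and F: "F (b', c') = (b, c)"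
    using F3_eq_Phi[of "(x, y, z)"] c by (simp_all add: abc Phi on23_def)
  have abc_closed: "a \<in> carrier M'" "b \<in> carrier M'" "c \<in> carrier M'"
    using F3_closed[of "(x, y, z)"] c by (simp_all add: abc carrier_new)
  have bc: "b \<otimes>\<^bsub>M'\<^esub> c = b' \<otimes>\<^bsub>M\<^esub> c'"
    using mul_F[of "(b', c')"] c' by (simp add: F mul_def)
  have "(a, b' \<otimes>\<^bsub>M\<^esub> c') = F (x, y \<otimes>\<^bsub>M\<^esub> z)"
    using twist.G3[OF c] by (simp add: Phi a mul23_def mul_def)
  then have "a \<otimes>\<^bsub>M'\<^esub> (b' \<otimes>\<^bsub>M\<^esub> c') = x \<otimes>\<^bsub>M\<^esub> (y \<otimes>\<^bsub>M\<^esub> z)"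
    using mul_F[of "(x, y \<otimes>\<^bsub>M\<^esub> z)"] c by (simp add: mul_def flip: \<open>_ = F _\<close>)
  then show ?thesis
    using c abc_closed by (simp add: bc new.mult.m_assoc old.mult.m_assoc)
qed

lemma fst_F3_trivial_product:
  assumes c: "x \<in> carrier M" "y \<in> carrier M" "z \<in> carrier M"
    and prod: "x \<otimes>\<^bsub>M\<^esub> y \<otimes>\<^bsub>M\<^esub> z = \<one>\<^bsub>M\<^esub>"
  shows "fst (F3 (x, y, z)) = additive_iso x"
proof -
  have "y \<otimes>\<^bsub>M\<^esub> z = inv\<^bsub>M\<^esub> x"
    using c prod by (metis old.mult.inv_equality old.mult.inv_inv old.mult.m_assoc
        old.mult.m_closed)
  then show ?thesis
    using c by (simp add: fst_F3 additive_iso_def)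
qed

lemma additive_iso_closed: "x \<in> carrier M \<Longrightarrow> additive_iso x \<in> carrier M"
  using F_closed[of "(x, inv\<^bsub>M\<^esub> x)"] by (auto simp: additive_iso_def)

lemma additive_iso_one: "additive_iso \<one>\<^bsub>M\<^esub> = \<one>\<^bsub>M\<^esub>"
  by (simp add: additive_iso_def twist.G2_left)

text \<open>The left-hand side is the additive form of the \<open>M'\<close>-product of \<open>F\<^sub>3 (x, y, z)\<close>: its second and
  third summands are first entries of triples in the braid orbit of \<open>F\<^sub>3 (x, y, z)\<close>, hence
  images under \<open>F\<^sub>3\<close> of triples in the orbit of \<open>(x, y, z)\<close>.\<close>

lemma additive_iso_trivial_product:
  assumes c: "x \<in> carrier M" "y \<in> carrier M" "z \<in> carrier M"
    and prod: "x \<otimes>\<^bsub>M\<^esub> y \<otimes>\<^bsub>M\<^esub> z = \<one>\<^bsub>M\<^esub>"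
  shows "additive_iso x \<otimes>\<^bsub>A'\<^esub> additive_iso (brace_sigma M A x y)
    \<otimes>\<^bsub>A'\<^esub> additive_iso (brace_sigma M A x (brace_sigma M A y z)) = \<one>\<^bsub>A'\<^esub>"
proof -
  let ?s = "brace_sigma M A" and ?g = "brace_gamma M A"
  obtain a b d where abd: "F3 (x, y, z) = (a, b, d)"
    by (cases "F3 (x, y, z)")
  have closed: "a \<in> carrier M'" "b \<in> carrier M'" "d \<in> carrier M'"
    using F3_closed[of "(x, y, z)"] c by (simp_all add: abd carrier_new)
  have r12: "fst (F3 (?s u v, ?g v u, w)) = brace_sigma M' A' a' b'"
    if "u \<in> carrier M" "v \<in> carrier M" "w \<in> carrier M" "F3 (u, v, w) = (a', b', d')"
    for u v w a' b' d'
    using arg_cong[OF F3_intertwines_12[of "(u, v, w)"], of fst] that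
    by (simp add: on12_def brace_braiding_def)
  have a: "a = additive_iso x"
    using fst_F3_trivial_product[OF c prod] by (simp add: abd)
  have b: "brace_sigma M' A' a b = additive_iso (?s x y)"
    using fst_F3_trivial_product[of "?s x y" "?g y x" z] c prod
    by (simp add: r12[OF c abd] old.sigma_gamma)
  have d: "brace_sigma M' A' a (brace_sigma M' A' b d) = additive_iso (?s x (?s y z))"
  proof -
    \<comment> \<open>Braiding the last two strands puts \<open>\<sigma>\<^sub>y z\<close> where \<open>r\<^sub>1\<^sub>2\<close> applies \<open>\<sigma>\<^sub>x\<close> to it.\<close>
    have r23: "F3 (x, ?s y z, ?g z y)
        = (a, brace_sigma M' A' b d, brace_gamma M' A' d b)"
      using F3_intertwines_23[of "(x, y, z)"] c by (simp add: abd on23_def brace_braiding_def)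
    have "?s x (?s y z) \<otimes>\<^bsub>M\<^esub> ?g (?s y z) x \<otimes>\<^bsub>M\<^esub> ?g z y = \<one>\<^bsub>M\<^esub>"
      using c prod by (simp add: old.sigma_gamma old.mult.m_assoc)
    then show ?thesis
      using fst_F3_trivial_product[of "?s x (?s y z)" "?g (?s y z) x" "?g z y"] c
      by (simp add: r12[OF _ _ _ r23])
  qed
  have "a \<otimes>\<^bsub>A'\<^esub> brace_sigma M' A' a b \<otimes>\<^bsub>A'\<^esub> brace_sigma M' A' a (brace_sigma M' A' b d)
      = \<one>\<^bsub>A'\<^esub>"
    using F3_preserves_product[OF c abd] closed
    by (simp add: new.mult3_eq_add_sigma prod new.one_eq one_new)
  then show ?thesis
    by (simp add: a b[unfolded a] d[unfolded a])
qed

lemma additive_iso_hom: "additive_iso \<in> hom A A'"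
proof (rule hom_if_preserves_trivial_triples)
  show "group A" "group A'"
    by (rule old.add.is_group new.add.is_group)+
  show "additive_iso u \<in> carrier A'" if "u \<in> carrier A" for u
    using that by (simp add: additive_iso_closed old.carrier_eq new.carrier_eq carrier_new)
  show "additive_iso \<one>\<^bsub>A\<^esub> = \<one>\<^bsub>A'\<^esub>"
    by (simp add: additive_iso_one old.one_eq new.one_eq one_new)
  fix u v assume "u \<in> carrier A" "v \<in> carrier A"
  then have u: "u \<in> carrier M" and v: "v \<in> carrier M"
    by (simp_all add: old.carrier_eq)
  \<comment> \<open>The triple of \<open>M\<close>-product \<open>1\<close> whose first two summands are \<open>u\<close> and \<open>v\<close>.\<close>
  define y where "y = inv\<^bsub>M\<^esub> u \<otimes>\<^bsub>M\<^esub> (u \<otimes>\<^bsub>A\<^esub> v)"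
  define z where "z = inv\<^bsub>M\<^esub> (u \<otimes>\<^bsub>A\<^esub> v)"
  have yz: "y \<in> carrier M" "z \<in> carrier M"
    using u v by (simp_all add: y_def z_def)
  have uy: "u \<otimes>\<^bsub>M\<^esub> y = u \<otimes>\<^bsub>A\<^esub> v"
    using u v by (simp add: y_def flip: old.mult.m_assoc)
  have uyz: "u \<otimes>\<^bsub>M\<^esub> y \<otimes>\<^bsub>M\<^esub> z = \<one>\<^bsub>M\<^esub>"
    using u v by (simp add: uy z_def)
  have "brace_sigma M A u y = v"
    using u v by (simp add: brace_sigma_def uy old.carrier_eq flip: old.add.m_assoc)
  moreover have "brace_sigma M A u (brace_sigma M A y z) = inv\<^bsub>A\<^esub> (u \<otimes>\<^bsub>A\<^esub> v)"
  proof -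
    have "brace_sigma M A u (brace_sigma M A y z) = brace_sigma M A (u \<otimes>\<^bsub>M\<^esub> y) z"
      using u yz by (simp add: old.sigma_mult)
    also have "\<dots> = inv\<^bsub>A\<^esub> (u \<otimes>\<^bsub>A\<^esub> v) \<otimes>\<^bsub>A\<^esub> \<one>\<^bsub>A\<^esub>"
      by (simp only: brace_sigma_def uyz) (simp only: uy old.one_eq)
    finally show ?thesis
      using u v by (simp add: old.carrier_eq)
  qed
  ultimately show "additive_iso u \<otimes>\<^bsub>A'\<^esub> additive_iso v
      \<otimes>\<^bsub>A'\<^esub> additive_iso (inv\<^bsub>A\<^esub> (u \<otimes>\<^bsub>A\<^esub> v)) = \<one>\<^bsub>A'\<^esub>"
    using additive_iso_trivial_product[OF u yz uyz] by simp
qed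

lemma F_inverse_pair:
  assumes "x \<in> carrier M"
  shows "F (x, inv\<^bsub>M\<^esub> x) = (additive_iso x, inv\<^bsub>M'\<^esub> (additive_iso x))"
proof -
  obtain a b where ab: "F (x, inv\<^bsub>M\<^esub> x) = (a, b)"
    by (cases "F (x, inv\<^bsub>M\<^esub> x)")
  have closed: "a \<in> carrier M'" "b \<in> carrier M'"
    using F_closed[of "(x, inv\<^bsub>M\<^esub> x)"] assms by (simp_all add: ab carrier_new)
  have "a \<otimes>\<^bsub>M'\<^esub> b = \<one>\<^bsub>M'\<^esub>"
    using mul_F[of "(x, inv\<^bsub>M\<^esub> x)"] assms by (simp add: ab mul_def one_new)
  then have "b = inv\<^bsub>M'\<^esub> a"
    using closed by (metis new.mult.inv_equality new.mult.inv_inv)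
  then show ?thesis
    by (simp add: ab additive_iso_def)
qed

lemma additive_iso_bij: "bij_betw additive_iso (carrier M) (carrier M)"
proof (rule bij_betw_imageI)
  show "inj_on additive_iso (carrier M)"
  proof (rule inj_onI)
    fix x y assume x: "x \<in> carrier M" and y: "y \<in> carrier M"
      and "additive_iso x = additive_iso y"
    then have "F (x, inv\<^bsub>M\<^esub> x) = F (y, inv\<^bsub>M\<^esub> y)"
      by (simp add: F_inverse_pair)
    then show "x = y"
      using bij_betw_imp_inj_on[OF twist.F_bij] x y by (auto dest: inj_onD)
  qed
  show "additive_iso ` carrier M = carrier M"
  proof
    show "additive_iso ` carrier M \<subseteq> carrier M"
      by (auto simp: additive_iso_closed)
    show "carrier M \<subseteq> additive_iso ` carrier M"
    proof
      fix u assume u: "u \<in> carrier M"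
      then have "(u, inv\<^bsub>M'\<^esub> u) \<in> carrier M \<times> carrier M"
        using new.mult.inv_closed[of u] by (simp add: carrier_new)
      then have "(u, inv\<^bsub>M'\<^esub> u) \<in> F ` (carrier M \<times> carrier M)"
        by (simp only: bij_betw_imp_surj_on[OF twist.F_bij])
      then obtain x y where xy: "x \<in> carrier M" "y \<in> carrier M"
        and F: "F (x, y) = (u, inv\<^bsub>M'\<^esub> u)"
        by (elim imageE SigmaE) simp
      have "x \<otimes>\<^bsub>M\<^esub> y = \<one>\<^bsub>M\<^esub>"
        using mul_F[of "(x, y)"] xy u by (simp add: F mul_def carrier_new one_new)
      then have "y = inv\<^bsub>M\<^esub> x"
        using xy by (metis old.mult.inv_equality old.mult.inv_inv)
      then have "u = additive_iso x"
        using F by (simp add: additive_iso_def)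
      then show "u \<in> additive_iso ` carrier M"
        using xy by blast
    qed
  qed
qed

lemma additive_iso_iso: "additive_iso \<in> iso A A'"
  using additive_iso_hom additive_iso_bij
  by (simp add: iso_def old.carrier_eq new.carrier_eq carrier_new)

end

theorem theorem2p7:
  fixes M :: "('a, 'b) monoid_scheme" and A :: "('a, 'c) monoid_scheme"
    and M' :: "('a, 'd) monoid_scheme" and A' :: "('a, 'e) monoid_scheme"
  assumes "skew_brace M A"
    and "skew_brace M' A'"
    and "carrier M' = carrier M"
    and "related_via_drinfeld_twist M A M' A'"
  shows "A \<cong> A'"
proof -
  obtain F \<Phi> \<Psi> where tw: "drinfeld_twist M (brace_braiding M A) F \<Phi> \<Psi>"
    and mul: "\<forall>p \<in> carrier M \<times> carrier M.
      mul M' p = mul M (inv_into (carrier M \<times> carrier M) F p)"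
    and one: "\<one>\<^bsub>M'\<^esub> = \<one>\<^bsub>M\<^esub>"
    and braiding: "\<forall>p \<in> carrier M \<times> carrier M. brace_braiding M' A' p
      = F (brace_braiding M A (inv_into (carrier M \<times> carrier M) F p))"
    using assms(4) unfolding related_via_drinfeld_twist_def by blast
  have bij: "bij_betw F (carrier M \<times> carrier M) (carrier M \<times> carrier M)"
    using tw by (rule drinfeld_twist.F_bij)
  have F: "F q \<in> carrier M \<times> carrier M" "inv_into (carrier M \<times> carrier M) F (F q) = q"
    if "q \<in> carrier M \<times> carrier M" for q
    using that bij_betw_apply[OF bij that] bij_betw_inv_into_left[OF bij that] by auto
  interpret twisted_skew_braces M A M' A' F \<Phi> \<Psi>
  proof (rule twisted_skew_braces.intro[OF assms(1,2) tw], unfold_locales)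
    fix q assume q: "q \<in> carrier M \<times> carrier M"
    show "mul M' (F q) = mul M q"
      using bspec[OF mul F(1)[OF q]] by (simp only: F(2)[OF q])
    show "brace_braiding M' A' (F q) = F (brace_braiding M A q)"
      using bspec[OF braiding F(1)[OF q]] by (simp only: F(2)[OF q])
  qed (fact assms(3) one)+
  show ?thesis
    using additive_iso_iso by (rule is_isoI)
qed

end
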